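(* Let $\mathbb X=\hat{\mathbb X}=\mathbb R^n$, let $\mathbb U=\hat{\mathbb U}$ be the input space, let $\Theta\subset\mathbb R^{\mathfrak p}$ be a bounded polytope and $\theta_0\in\Theta$. Let $f(\cdot,\cdot;\theta):\mathbb X\times\mathbb U\to\mathbb X$ ($\theta\in\Theta$) and $h:\mathbb X\to\mathbb Y$ be measurable, and suppose there is a function $d$ with $\|f(x,u;\theta)-f(x,u;\theta_0)\|\le d(x,u)<\infty$ for all $x\in\mathbb X$, $u\in\mathbb U$, $\theta\in\Theta$. For $\theta\in\Theta$ consider the nonlinear system $$\mathbf M(\theta):\quad x_{k+1}=f(x_k,u_k;\theta)+w_k,\qquad y_k=h(x_k),$$ and the nominal model $$\widehat{\mathbf M}:\quad \hat x_{k+1}=f(\hat x_k,\hat u_k;\theta_0)+\hat w_k,\qquad \hat y_k=h(\hat x_k),$$ where $(w_k)$ and $(\hat w_k)$ are i.i.d. with distribution $\mathcal N(0,I)$, and the initial states satisfy $\hat x_0=x_0$. Let $\gamma(x,u,\theta):=f(x,u;\theta)-f(x,u;\theta_0)$, $\varepsilon=0$ and $$\delta(\hat x,\hat u)=\sup_{\theta\in\Theta}\Big\{1-2\,\mathrm{cdf}\big(-\tfrac12\|\gamma(\hat x,\hat u,\theta)\|\big)\Big\},\qquad \mathrm{cdf}(\alpha)=\int_{-\infty}^{\alpha}\tfrac{1}{\sqrt{2\pi}}e^{-\beta^2/2}\,d\beta.$$ Then for every $\theta\in\Theta$, $\widehat{\mathbf M}\preceq^{\delta}_{\varepsilon}\mathbf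 M(\theta)$ with the state- and input-dependent $\delta=\delta(\hat x,\hat u)$, interface function $u_k=\hat u_k$, relation $\mathcal R=\{(\hat x,x)\in\hat{\mathbb X}\times\mathbb X:x=\hat x\}$, and sub-probability kernel $$\boldsymbol v(d\hat x^+\times dx^+\mid\hat x,x,\hat u;\theta)=\int_{\hat w}\int_w\delta_{f(\hat x,\hat u;\theta_0)+\hat w}(d\hat x^+)\,\delta_{f(x,u;\theta)+w}(dx^+)\,\delta_{\gamma+w}(d\hat w)\,\min\{\mathcal N(dw\mid0,I),\mathcal N(dw\mid-\gamma,I)\},$$ where $u=\hat u$ and $\gamma=\gamma(x,u,\theta)$. Moreover, the state mapping, which does not depend on $\theta$, given by $$\hat x^+=x^+-f(x,u;\theta_0)+f(\hat x,\hat u;\theta_0),\qquad u=\hat u,$$ i.e. $\mathbf s(\cdot\mid\hat x,x,x^+,\hat u)=\delta_{x^+-f(x,\hat u;\theta_0)+f(\hat x,\hat u;\theta_0)}$, defines a valid control refinement (with respect to this interface function and $\boldsymbol v(\cdot;\theta)$) for every $\theta\in\Theta$.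
   Context: All spaces are Polish with Borel $\sigma$-algebras. $\delta_a$ with a point subscript denotes the Dirac measure at $a$ (the function $\delta(\cdot,\cdot)$ is unrelated); $\mathcal N(\cdot\mid m,\Sigma)$ is the Gaussian measure with mean $m$ and covariance $\Sigma$; $\|\cdot\|$ is the Euclidean norm; the minimum of two measures having Lebesgue densities is the measure whose density is the pointwise minimum of the densities. A general Markov decision process (gMDP) is a tuple $\mathbf M=(\mathbb X,x_0,\mathbb U,\mathbf t,h,\mathbb Y)$ with state space $\mathbb X$, initial state $x_0\in\mathbb X$, input space $\mathbb U$, probability kernel $\mathbf t(\cdot\mid x,u)$ on $\mathbb X$ given $(x,u)$, and measurable output map $h:\mathbb X\to\mathbb Y$, with a metric $\mathbf d_{\mathbb Y}$ on $\mathbb Y$. The systems in the claim are regarded as gMDPs with common output space $(\mathbb Y,\mathbf d_{\mathbb Y})$ and transition kernels $\mathbf t(\cdot\mid x,u;\theta)=\mathcal N(\cdot\mid f(x,u;\theta),I)$ and $\hat{\mathbf t}(\cdot\mid\hat x,\hat u)=\mathcal N(\cdot\mid f(\hat x,\hat u;\theta_0),I)$, and output map $h$ (so $\hat h=h$). Interface function: a measurable rule $\mathbf i$ assigning to $(\hat x,x,\hat u)$ an input $u\in\mathbb U$ for $\mathbf M$; here $\mathbf i(\hat x,x,\hat u)=\hat u$. Sub-probability coupling: given probability measures $p$ on $\mathbb X$ and $\hat p$ on $\hat{\mathbb X}$, $\mathcal R\subset\hat{\mathbb X}\times\mathbb X$ and a number $\delta\in[0,1]$, a measure $v$ on $\hat{\mathbb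 X}\times\mathbb X$ of total mass at most $1$ and with $v(\hat{\mathbb X}\times\mathbb X)\ge1-\delta$ is a sub-probability coupling of $\hat p$ and $p$ over $\mathcal R$ (with respect to $\delta$) if (a) $v(\hat{\mathbb X}\times\mathbb X)=v(\mathcal R)$; (b) $v(S\times\mathbb X)\le\hat p(S)$ for all measurable $S\subset\hat{\mathbb X}$; (c) $v(\hat{\mathbb X}\times S)\le p(S)$ for all measurable $S\subset\mathbb X$. $(\varepsilon,\delta)$-sub-simulation relation with state- and input-dependent $\delta(\hat x,\hat u)$: $\widehat{\mathbf M}\preceq^\delta_\varepsilon\mathbf M$, with measurable relation $\mathcal R\subset\hat{\mathbb X}\times\mathbb X$, interface function $\mathbf i$ and sub-probability kernel $\boldsymbol v(\cdot\mid\hat x,x,\hat u)$ on $\hat{\mathbb X}\times\mathbb X$, means: (a) $(\hat x_0,x_0)\in\mathcal R$; (b) for all $(\hat x,x)\in\mathcal R$ and $\hat u\in\hat{\mathbb U}$, $\boldsymbol v(\cdot\mid\hat x,x,\hat u)$ is a sub-probability coupling of $\hat{\mathbf t}(\cdot\mid\hat x,\hat u)$ and $\mathbf t(\cdot\mid x,\mathbf i(\hat x,x,\hat u))$ over $\mathcal R$ with respect to $\delta(\hat x,\hat u)$; (c) $\mathbf d_{\mathbb Y}(\hat h(\hat x),h(x))\le\varepsilon$ for all $(\hat x,x)\in\mathcal R$. Valid control refinement: a stochastic kernel (state mapping) $\mathbf s(\cdot\mid\hat x,x,x^+,\hat u)$ on $\hat{\mathbb X}$ defines a valid control refinement for $\mathbf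 i$ and $\boldsymbol v$ if for all measurable $S\subset\hat{\mathbb X}\times\mathbb X$, all $(\hat x,x)\in\mathcal R$ and all $\hat u\in\hat{\mathbb U}$, $$\int_{(\hat x^+,x^+)\in S}\mathbf s(d\hat x^+\mid\hat x,x,x^+,\hat u)\,\mathbf t(dx^+\mid x,\mathbf i(\hat x,x,\hat u))\ge\boldsymbol v(S\mid\hat x,x,\hat u).$$ *)

theory Defs
  imports "HOL-Probability.Probability"
begin

text \<open>
  State, input and output spaces are Polish spaces with their Borel sigma-algebras, rendered as
  types of class \<^class>\<open>polish_space\<close>. On products of such types \<open>borel \<Otimes>\<^sub>M borel\<close> is the
  Borel sigma-algebra. The metric on the output space, with respect to which output
  deviations are measured, is an explicit parameter \<open>d\<^sub>Y\<close> of the notions below; it need not be the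
  complete metric \<^const>\<open>dist\<close> of the type class.
\<close>

record ('x, 'u, 'y) gmdp =
  init_state :: 'x
  kernel :: "'x \<Rightarrow> 'u \<Rightarrow> 'x measure"
  out_map :: "'x \<Rightarrow> 'y"

definition is_gmdp ::
  "('x::polish_space, 'u::polish_space, 'y::polish_space) gmdp \<Rightarrow> bool" where
  "is_gmdp M \<longleftrightarrow>
     (\<lambda>(x, u). kernel M x u) \<in> borel \<Otimes>\<^sub>M borel \<rightarrow>\<^sub>M prob_algebra borel \<and>
     out_map M \<in> borel \<rightarrow>\<^sub>M borel"

definition is_interface ::
  "('xh::polish_space \<Rightarrow> 'x::polish_space \<Rightarrow> 'uh::polish_space \<Rightarrow> 'u::polish_space) \<Rightarrow> bool" where
  "is_interface i \<longleftrightarrow>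
     (\<lambda>(xh, x, uh). i xh x uh) \<in> borel \<Otimes>\<^sub>M (borel \<Otimes>\<^sub>M borel) \<rightarrow>\<^sub>M borel"

definition subprob_coupling ::
  "('xh::polish_space \<times> 'x::polish_space) set \<Rightarrow> real \<Rightarrow> 'xh measure \<Rightarrow> 'x measure
     \<Rightarrow> ('xh \<times> 'x) measure \<Rightarrow> bool" where
  "subprob_coupling R \<delta> ph p v \<longleftrightarrow>
     0 \<le> \<delta> \<and> \<delta> \<le> 1 \<and>
     ph \<in> space (prob_algebra borel) \<and> p \<in> space (prob_algebra borel) \<and>
     sets v = sets (borel \<Otimes>\<^sub>M borel) \<and>
     emeasure v UNIV \<le> 1 \<and> emeasure v UNIV \<ge> ennreal (1 - \<delta>) \<and>
     emeasure v UNIV = emeasure v R \<and>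
     (\<forall>S\<in>sets borel. emeasure v (S \<times> UNIV) \<le> emeasure ph S) \<and>
     (\<forall>S\<in>sets borel. emeasure v (UNIV \<times> S) \<le> emeasure p S)"

definition sub_simulation ::
  "('y::polish_space \<Rightarrow> 'y \<Rightarrow> real) \<Rightarrow> real \<Rightarrow> ('xh::polish_space \<Rightarrow> 'uh::polish_space \<Rightarrow> real)
     \<Rightarrow> ('xh, 'uh, 'y) gmdp \<Rightarrow> ('x::polish_space, 'u::polish_space, 'y) gmdp
     \<Rightarrow> ('xh \<times> 'x) set \<Rightarrow> ('xh \<Rightarrow> 'x \<Rightarrow> 'uh \<Rightarrow> 'u) \<Rightarrow> ('xh \<Rightarrow> 'x \<Rightarrow> 'uh \<Rightarrow> ('xh \<times> 'x) measure) \<Rightarrow> bool"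
  where
  "sub_simulation d\<^sub>Y \<epsilon> \<delta> Mh M R i v \<longleftrightarrow>
     is_gmdp Mh \<and> is_gmdp M \<and>
     R \<in> sets (borel \<Otimes>\<^sub>M borel) \<and> is_interface i \<and>
     (\<lambda>(xh, x, uh). v xh x uh)
       \<in> borel \<Otimes>\<^sub>M (borel \<Otimes>\<^sub>M borel) \<rightarrow>\<^sub>M subprob_algebra (borel \<Otimes>\<^sub>M borel) \<and>
     (init_state Mh, init_state M) \<in> R \<and>
     (\<forall>(xh, x)\<in>R. \<forall>uh.
        subprob_coupling R (\<delta> xh uh) (kernel Mh xh uh) (kernel M x (i xh x uh)) (v xh x uh)) \<and>
     (\<forall>(xh, x)\<in>R. d\<^sub>Y (out_map Mh xh) (out_map M x) \<le> \<epsilon>)"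

definition valid_control_refinement ::
  "('x::polish_space, 'u::polish_space, 'y::polish_space) gmdp \<Rightarrow> ('xh::polish_space \<times> 'x) set
     \<Rightarrow> ('xh \<Rightarrow> 'x \<Rightarrow> 'uh::polish_space \<Rightarrow> 'u) \<Rightarrow> ('xh \<Rightarrow> 'x \<Rightarrow> 'uh \<Rightarrow> ('xh \<times> 'x) measure)
     \<Rightarrow> ('xh \<Rightarrow> 'x \<Rightarrow> 'x \<Rightarrow> 'uh \<Rightarrow> 'xh measure) \<Rightarrow> bool" where
  "valid_control_refinement M R i v s \<longleftrightarrow>
     (\<lambda>(xh, x, x', uh). s xh x x' uh)
       \<in> borel \<Otimes>\<^sub>M (borel \<Otimes>\<^sub>M (borel \<Otimes>\<^sub>M borel)) \<rightarrow>\<^sub>M prob_algebra borel \<and>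
     (\<forall>S\<in>sets (borel \<Otimes>\<^sub>M borel). \<forall>(xh, x)\<in>R. \<forall>uh.
        (\<integral>\<^sup>+ x'. (\<integral>\<^sup>+ xh'. indicator S (xh', x') \<partial>s xh x x' uh) \<partial>kernel M x (i xh x uh))
          \<ge> emeasure (v xh x uh) S)"

text \<open>The covariance matrix \<open>C\<close> is meant to be symmetric positive definite.\<close>

definition gaussian_density :: "real^'n \<Rightarrow> real^'n^'n \<Rightarrow> real^'n \<Rightarrow> real" where
  "gaussian_density m C x =
     exp (- ((x - m) \<bullet> (matrix_inv C *v (x - m))) / 2) / sqrt ((2 * pi) ^ CARD('n) * det C)"

definition gaussian :: "real^'n \<Rightarrow> real^'n^'n \<Rightarrow> (real^'n) measure" where
  "gaussian m C = density lborel (\<lambda>x. ennreal (gaussian_density m C x))"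

text \<open>
  Meant for measures that have Lebesgue densities: \<^const>\<open>RN_deriv\<close> selects one, and the result does
  not depend on the choice since densities agree almost everywhere.
\<close>

definition min_measure ::
  "'a::euclidean_space measure \<Rightarrow> 'a measure \<Rightarrow> 'a measure" where
  "min_measure \<mu> \<nu> = density lborel (\<lambda>x. min (RN_deriv lborel \<mu> x) (RN_deriv lborel \<nu> x))"

definition std_normal_cdf :: "real \<Rightarrow> real" where
  "std_normal_cdf \<alpha> = (LINT \<beta>:{..\<alpha>}|lborel. 1 / sqrt (2 * pi) * exp (- \<beta>\<^sup>2 / 2))"

text \<open>
  The system \<open>x' = f(x, u; \<theta>) + w\<close>, \<open>y = h(x)\<close> with i.i.d. standard Gaussian \<open>w\<close>, regarded as a gMDP:
  \<open>x'\<close> has law \<open>N(f(x, u; \<theta>), I)\<close>.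
\<close>

definition noisy_system ::
  "(real^'n \<Rightarrow> 'u \<Rightarrow> 'p \<Rightarrow> real^'n) \<Rightarrow> (real^'n \<Rightarrow> 'y) \<Rightarrow> real^'n \<Rightarrow> 'p \<Rightarrow> (real^'n, 'u, 'y) gmdp" where
  "noisy_system f h x\<^sub>0 \<theta> =
     \<lparr> init_state = x\<^sub>0, kernel = (\<lambda>x u. gaussian (f x u \<theta>) (mat 1)), out_map = h \<rparr>"

definition deviation ::
  "(real^'n \<Rightarrow> 'u \<Rightarrow> 'p \<Rightarrow> real^'n) \<Rightarrow> 'p \<Rightarrow> real^'n \<Rightarrow> 'u \<Rightarrow> 'p \<Rightarrow> real^'n" where
  "deviation f \<theta>\<^sub>0 x u \<theta> = f x u \<theta> - f x u \<theta>\<^sub>0"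

text \<open>The supremum is over a set of reals bounded above by 1, which is nonempty when \<open>\<Theta>\<close> is.\<close>

definition delta_sup ::
  "(real^'n \<Rightarrow> 'u \<Rightarrow> 'p \<Rightarrow> real^'n) \<Rightarrow> 'p set \<Rightarrow> 'p \<Rightarrow> real^'n \<Rightarrow> 'u \<Rightarrow> real" where
  "delta_sup f \<Theta> \<theta>\<^sub>0 xh uh =
     (SUP \<theta>\<in>\<Theta>. 1 - 2 * std_normal_cdf (- (1 / 2) * norm (deviation f \<theta>\<^sub>0 xh uh \<theta>)))"

text \<open>
  The outer bind integrates over \<open>w\<close> against the minimum of the two Gaussian measures, the inner one
  over \<open>wh\<close> against the Dirac measure at \<open>\<gamma> + w\<close>; the integrand is the product of the Dirac measures
  at the two successor states.
\<close>

definition coupling_kernel ::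
  "(real^'n \<Rightarrow> 'u \<Rightarrow> 'p \<Rightarrow> real^'n) \<Rightarrow> 'p \<Rightarrow> 'p \<Rightarrow> real^'n \<Rightarrow> real^'n \<Rightarrow> 'u
     \<Rightarrow> ((real^'n) \<times> (real^'n)) measure" where
  "coupling_kernel f \<theta>\<^sub>0 \<theta> xh x uh =
     (let u = uh; \<gamma> = deviation f \<theta>\<^sub>0 x u \<theta> in
      bind (min_measure (gaussian 0 (mat 1)) (gaussian (- \<gamma>) (mat 1))) (\<lambda>w.
        bind (return borel (\<gamma> + w)) (\<lambda>wh.
          return borel (f xh uh \<theta>\<^sub>0 + wh) \<Otimes>\<^sub>M return borel (f x u \<theta> + w))))"

definition state_mapping ::
  "(real^'n \<Rightarrow> 'u \<Rightarrow> 'p \<Rightarrow> real^'n) \<Rightarrow> 'p \<Rightarrow> real^'n \<Rightarrow> real^'n \<Rightarrow> real^'n \<Rightarrow> 'u \<Rightarrow> (real^'n) measure"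
  where
  "state_mapping f \<theta>\<^sub>0 xh x x' uh = return borel (x' - f x uh \<theta>\<^sub>0 + f xh uh \<theta>\<^sub>0)"

end

theory Submission
  imports Defs
begin

text \<open>
  On the diagonal \<open>xh = x\<close> both successors under the coupling equal \<open>f x u \<theta> + w\<close>, so the coupling is
  the diagonal image of the minimum of \<open>N(f x u \<theta>\<^sub>0, I)\<close> and \<open>N(f x u \<theta>, I)\<close>: it lives on the diagonal
  and is dominated by the diagonal image of either Gaussian, which gives the marginal bounds and,
  since the state mapping returns \<open>x'\<close> itself, the refinement property.
  The total mass is computed by splitting the space along the hyperplane bisecting the two means.
  On each side the minimum is the Gaussian with the farther mean, whose mass there is
  \<open>cdf (- norm \<gamma> / 2)\<close>, because the standard Gaussian projected onto a unit vector is \<open>N(0, 1)\<close>.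
\<close>

section \<open>The standard Gaussian measure on a Euclidean space\<close>

abbreviation std_normal :: "real measure" where
  "std_normal \<equiv> density lborel (\<lambda>x. ennreal (std_normal_density x))"

text \<open>The product over the basis makes probabilities of boxes factor;
  \<open>std_gaussian_density_eq\<close> supplies the radial form, which is used to compare
  densities and to match \<open>gaussian_density\<close>. The type is general because the case of
  \<open>real\<close> is used as well.\<close>

definition std_gaussian_density :: "'a::euclidean_space \<Rightarrow> real" where
  "std_gaussian_density x = (\<Prod>b\<in>Basis. std_normal_density (x \<bullet> b))"

definition std_gaussian :: "'a::euclidean_space measure" where
  "std_gaussian = density lborel (\<lambda>x. ennreal (std_gaussian_density x))"

lemma std_gaussian_density_measurable [measurable]: "std_gaussian_density \<in> borel_measurable borel"
  unfolding std_gaussian_density_def[abs_def] by measurable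

lemma std_gaussian_density_eq:
  "std_gaussian_density (x::'a::euclidean_space) = exp (- (x \<bullet> x) / 2) / sqrt ((2 * pi) ^ DIM('a))"
proof -
  have "std_gaussian_density x = (\<Prod>b\<in>(Basis :: 'a set). 1 / sqrt (2 * pi)) * exp (\<Sum>b\<in>Basis. - (x \<bullet> b)\<^sup>2 / 2)"
    unfolding std_gaussian_density_def std_normal_density_def prod.distrib exp_sum[OF finite_Basis] by simp
  also have "(\<Sum>b\<in>Basis. - (x \<bullet> b)\<^sup>2 / 2) = - (x \<bullet> x) / 2"
    unfolding euclidean_inner[of x x] sum_divide_distrib[symmetric]
    by (simp add: sum_negf power2_eq_square)
  finally show ?thesis unfolding real_sqrt_power by (simp add: power_divide)
qed

lemma std_gaussian_density_nonneg [simp]: "0 \<le> std_gaussian_density x"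
  by (simp add: std_gaussian_density_def prod_nonneg)

text \<open>The density is strictly decreasing in the squared norm. Comparing two shifted Gaussians
  thus becomes comparing distances to their means, which is how a half-space arises in
  \<open>gaussian_overlap_mass_ge\<close>.\<close>

lemma std_gaussian_density_le_iff:
  fixes x y :: "'a::euclidean_space"
  shows "std_gaussian_density x \<le> std_gaussian_density y \<longleftrightarrow> y \<bullet> y \<le> x \<bullet> x"
proof -
  have "0 < sqrt ((2 * pi) ^ DIM('a))" by simp
  then show ?thesis
    unfolding std_gaussian_density_eq divide_le_cancel by (simp del: real_sqrt_gt_0_iff real_sqrt_lt_0_iff add: less_le_not_le)
qed

lemma sets_std_gaussian [simp, measurable_cong]: "sets std_gaussian = sets borel"
  by (simp add: std_gaussian_def)

lemma space_std_gaussian [simp]: "space std_gaussian = UNIV"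
  by (simp add: std_gaussian_def)

lemma prob_space_std_normal: "prob_space std_normal"
  by (rule prob_space_normal_density) simp

text \<open>The density and the indicator of a box are both products of functions of single
  coordinates, so Tonelli splits the integral. Normalisation and independence of the coordinates are
  both read off from this formula.\<close>

lemma emeasure_std_gaussian_box:
  fixes A :: "'a::euclidean_space \<Rightarrow> real set"
  assumes A [measurable]: "\<And>b. b \<in> Basis \<Longrightarrow> A b \<in> sets borel"
  shows "emeasure std_gaussian {x. \<forall>b\<in>Basis. x \<bullet> b \<in> A b} = (\<Prod>b\<in>Basis. emeasure std_normal (A b))"
proof -
  have [measurable]: "{x. \<forall>b\<in>Basis. x \<bullet> b \<in> A b} \<in> sets borel"
    by measurable
  have "emeasure std_gaussian {x. \<forall>b\<in>Basis. x \<bullet> b \<in> A b}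
      = (\<integral>\<^sup>+x. ennreal (std_gaussian_density x) * indicator {x. \<forall>b\<in>Basis. x \<bullet> b \<in> A b} x \<partial>lborel)"
    unfolding std_gaussian_def by (subst emeasure_density) auto
  also have "\<dots> = (\<integral>\<^sup>+x. (\<Prod>b\<in>Basis. ennreal (std_normal_density (x \<bullet> b)) * indicator (A b) (x \<bullet> b)) \<partial>lborel)"
  proof (rule nn_integral_cong)
    fix x :: 'a
    have "(indicator {x. \<forall>b\<in>Basis. x \<bullet> b \<in> A b} x :: ennreal) = (\<Prod>b\<in>Basis. indicator (A b) (x \<bullet> b))"
      by (auto simp: indicator_def prod_zero_iff)
    then show "ennreal (std_gaussian_density x) * indicator {x. \<forall>b\<in>Basis. x \<bullet> b \<in> A b} x
        = (\<Prod>b\<in>Basis. ennreal (std_normal_density (x \<bullet> b)) * indicator (A b) (x \<bullet> b))"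
      by (simp add: std_gaussian_density_def prod.distrib prod_ennreal)
  qed
  also have "\<dots> = (\<Prod>b\<in>Basis. (\<integral>\<^sup>+x. ennreal (std_normal_density x) * indicator (A b) x \<partial>lborel))"
    by (rule nn_integral_lborel_prod) auto
  also have "\<dots> = (\<Prod>b\<in>Basis. emeasure std_normal (A b))"
    by (intro prod.cong refl) (subst emeasure_density, auto)
  finally show ?thesis .
qed

lemma prob_space_std_gaussian: "prob_space std_gaussian"
proof
  have "emeasure std_normal UNIV = 1"
    using prob_space.emeasure_space_1[OF prob_space_std_normal] by simp
  then show "emeasure (std_gaussian :: 'a measure) (space std_gaussian) = 1"
    using emeasure_std_gaussian_box[of "\<lambda>_::'a. UNIV"] by simp
qed

interpretation std_gaussian: prob_space "std_gaussian :: 'a::euclidean_space measure"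
  by (rule prob_space_std_gaussian)

text \<open>Coordinates outside \<open>J\<close> are constrained by \<open>UNIV\<close>, which
  contributes a factor 1. Independence has to be checked on every subfamily of coordinates, hence
  this form.\<close>

lemma emeasure_std_gaussian_Ball_subset:
  fixes A :: "'a::euclidean_space \<Rightarrow> real set"
  assumes J: "J \<subseteq> Basis" and A: "\<And>b. b \<in> J \<Longrightarrow> A b \<in> sets borel"
  shows "emeasure std_gaussian {x. \<forall>b\<in>J. x \<bullet> b \<in> A b} = (\<Prod>b\<in>J. emeasure std_normal (A b))"
proof -
  let ?A = "\<lambda>b. if b \<in> J then A b else UNIV"
  have 1: "emeasure std_normal UNIV = 1"
    using prob_space.emeasure_space_1[OF prob_space_std_normal] by simp
  have "{x. \<forall>b\<in>J. x \<bullet> b \<in> A b} = {x. \<forall>b\<in>Basis. x \<bullet> b \<in> ?A b}"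
    using J by auto
  also have "emeasure std_gaussian \<dots> = (\<Prod>b\<in>Basis. emeasure std_normal (?A b))"
    by (rule emeasure_std_gaussian_box) (auto simp: A)
  also have "\<dots> = (\<Prod>b\<in>J. emeasure std_normal (A b))"
    using J by (intro prod.mono_neutral_cong_right) (auto simp: 1)
  finally show ?thesis .
qed

section \<open>Projections of the standard Gaussian onto unit vectors\<close>

lemma distributed_std_gaussian_component:
  fixes b :: "'a::euclidean_space"
  assumes "b \<in> Basis"
  shows "distributed std_gaussian lborel (\<lambda>x. x \<bullet> b) std_normal_density"
  unfolding distributed_def
proof (intro conjI)
  show "distr std_gaussian lborel (\<lambda>x. x \<bullet> b) = std_normal"
  proof (rule measure_eqI)
    fix S assume "S \<in> sets (distr (std_gaussian :: 'a measure) lborel (\<lambda>x. x \<bullet> b))"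
    then have S [measurable]: "S \<in> sets borel" by simp
    have "emeasure (distr std_gaussian lborel (\<lambda>x. x \<bullet> b)) S = emeasure std_gaussian {x. \<forall>c\<in>{b}. x \<bullet> c \<in> S}"
      by (subst emeasure_distr) (auto simp: vimage_def)
    also have "\<dots> = emeasure std_normal S"
      using assms S by (subst emeasure_std_gaussian_Ball_subset) auto
    finally show "emeasure (distr std_gaussian lborel (\<lambda>x. x \<bullet> b)) S = emeasure std_normal S" .
  qed simp
qed auto

text \<open>Events generated by single coordinates are cylinders, and an intersection of cylinders
  is a box; the product rule is the previous box formula, used for \<open>J\<close> and for each
  singleton.\<close>

lemma indep_vars_std_gaussian_components:
  "std_gaussian.indep_vars (\<lambda>_. borel) (\<lambda>(b::'a::euclidean_space) x. x \<bullet> b) Basis"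
  unfolding std_gaussian.indep_vars_def2
proof (intro conjI ballI std_gaussian.indep_setsI)
  fix S :: "'a \<Rightarrow> 'a set" and J :: "'a set"
  assume J: "J \<subseteq> Basis" "J \<noteq> {}" "finite J"
    and "\<forall>j\<in>J. S j \<in> {(\<lambda>x. x \<bullet> j) -` A \<inter> space std_gaussian |A. A \<in> sets borel}"
  then have "\<forall>j\<in>J. \<exists>A. A \<in> sets borel \<and> S j = {x. x \<bullet> j \<in> A}"
    by (auto simp: vimage_def)
  then obtain A where A: "\<And>j. j \<in> J \<Longrightarrow> A j \<in> sets borel" and S: "\<And>j. j \<in> J \<Longrightarrow> S j = {x. x \<bullet> j \<in> A j}"
    by metis
  have "(\<Inter>j\<in>J. S j) = {x. \<forall>j\<in>J. x \<bullet> j \<in> A j}"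
    using S by auto
  moreover have "emeasure std_gaussian (S j) = emeasure std_normal (A j)" if "j \<in> J" for j
    using emeasure_std_gaussian_Ball_subset[of "{j}" A] that J A S by auto
  ultimately have "emeasure std_gaussian (\<Inter>j\<in>J. S j) = (\<Prod>j\<in>J. emeasure std_gaussian (S j))"
    using emeasure_std_gaussian_Ball_subset[of J A] J A by simp
  then show "std_gaussian.prob (\<Inter>j\<in>J. S j) = (\<Prod>j\<in>J. std_gaussian.prob (S j))"
    by (simp add: std_gaussian.emeasure_eq_measure prod_ennreal prod_nonneg)
qed (auto intro: measurable_sets_borel[where M=borel])

text \<open>In coordinates the projection is a sum of independent centred normals with variances
  \<open>(e \<bullet> b)\<^sup>2\<close>, and these add up to the squared norm of \<open>e\<close>,
  which is 1.\<close>

lemma distributed_std_gaussian_inner: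
  fixes e :: "'a::euclidean_space"
  assumes e: "norm e = 1"
  shows "distributed std_gaussian lborel (\<lambda>x. x \<bullet> e) std_normal_density"
proof -
  \<comment> \<open>A summand with \<open>e \<bullet> b = 0\<close> is constant and has no normal
    density, so it must be dropped before the theorem on sums of independent normals
    applies.\<close>
  define J where "J = {b\<in>Basis. e \<bullet> b \<noteq> 0}"
  have J: "finite J" "J \<subseteq> Basis" by (auto simp: J_def)
  have J_sum: "(\<Sum>b\<in>J. g b) = (\<Sum>b\<in>Basis. g b)" if "\<And>b. e \<bullet> b = 0 \<Longrightarrow> g b = 0" for g :: "'a \<Rightarrow> real"
    using that by (intro sum.mono_neutral_left) (auto simp: J_def)
  have "(\<Sum>b\<in>Basis. (e \<bullet> b)\<^sup>2) = e \<bullet> e"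
    by (simp add: euclidean_inner[of e e] power2_eq_square)
  then have var: "(\<Sum>b\<in>J. \<bar>e \<bullet> b\<bar>\<^sup>2) = 1"
    using e by (simp add: J_sum norm_eq_1)
  then have "J \<noteq> {}" by auto
  have "std_gaussian.indep_vars (\<lambda>_. borel) (\<lambda>(b::'a) x. x \<bullet> b) J"
    by (rule std_gaussian.indep_vars_subset[OF indep_vars_std_gaussian_components J(2)])
  then have indep: "std_gaussian.indep_vars (\<lambda>_. borel) (\<lambda>(b::'a) x. (e \<bullet> b) * (x \<bullet> b)) J"
    using std_gaussian.indep_vars_compose[of "\<lambda>_. borel" "\<lambda>(b::'a) x. x \<bullet> b" J "\<lambda>b t. (e \<bullet> b) * t" "\<lambda>_. borel"]
    by (auto simp: comp_def)
  have normal: "distributed std_gaussian lborel (\<lambda>x. (e \<bullet> b) * (x \<bullet> b)) (normal_density 0 \<bar>e \<bullet> b\<bar>)"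
    if "b \<in> J" for b
    using std_gaussian.normal_density_affine[OF distributed_std_gaussian_component, of b "e \<bullet> b" 0] that
    by (simp add: J_def)
  have "distributed std_gaussian lborel (\<lambda>x. \<Sum>b\<in>J. (e \<bullet> b) * (x \<bullet> b))
      (normal_density (\<Sum>b\<in>J. 0) (sqrt (\<Sum>b\<in>J. \<bar>e \<bullet> b\<bar>\<^sup>2)))"
    by (rule std_gaussian.sum_indep_normal[OF J(1) \<open>J \<noteq> {}\<close> indep _ normal]) (auto simp: J_def)
  moreover have "(\<Sum>b\<in>J. (e \<bullet> b) * (x \<bullet> b)) = x \<bullet> e" for x
    by (subst J_sum) (auto simp: euclidean_inner[of x e] mult.commute)
  ultimately show ?thesis
    using var by simp
qed

lemma emeasure_std_gaussian_inner:
  fixes e :: "'a::euclidean_space"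
  assumes "norm e = 1" and S: "S \<in> sets borel"
  shows "emeasure std_gaussian {x. x \<bullet> e \<in> S} = emeasure std_normal S"
proof -
  have "emeasure (distr std_gaussian lborel (\<lambda>x. x \<bullet> e)) S = emeasure std_gaussian {x. x \<bullet> e \<in> S}"
    using S by (subst emeasure_distr) (auto simp: vimage_def)
  then show ?thesis
    using distributed_std_gaussian_inner[OF assms(1)] by (simp add: distributed_def)
qed

section \<open>The standard normal distribution function\<close>

lemma std_normal_cdf_eq: "std_normal_cdf a = measure std_normal {..a}"
proof -
  have "std_normal_cdf a = (LINT x|lborel. std_normal_density x * indicator {..a} x)"
    by (simp add: std_normal_cdf_def set_lebesgue_integral_def std_normal_density_def mult.commute)
  also have "\<dots> = (LINT x|std_normal. indicator {..a} x)"
    by (subst integral_density) auto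
  finally show ?thesis by simp
qed

lemma emeasure_std_normal_atMost: "emeasure std_normal {..a} = ennreal (std_normal_cdf a)"
  by (simp add: std_normal_cdf_eq finite_measure.emeasure_eq_measure
      prob_space.finite_measure prob_space_std_normal)

text \<open>The normal law has no atoms. The open half-line is needed because one of two
  complementary half-spaces is open.\<close>

lemma emeasure_std_normal_lessThan: "emeasure std_normal {..<a} = ennreal (std_normal_cdf a)"
proof -
  have "emeasure std_normal {..<a} = emeasure std_normal {..a}"
    by (rule emeasure_eq_AE) (use AE_lborel_singleton[of a] in \<open>auto simp: AE_density\<close>)
  then show ?thesis by (simp add: emeasure_std_normal_atMost)
qed

text \<open>In \<open>real\<close>, seen as a one-dimensional Euclidean space, 1 and -1 are both
  unit vectors, so the projections onto them have the same law.\<close>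

lemma emeasure_std_normal_uminus:
  assumes "S \<in> sets borel"
  shows "emeasure std_normal {x. - x \<in> S} = emeasure std_normal S"
proof -
  have "emeasure std_normal {x. - x \<in> S} = emeasure std_gaussian {x::real. x \<bullet> (-1) \<in> S}"
    using assms emeasure_std_gaussian_inner[of "1::real" "{x. - x \<in> S}"] by simp
  also have "\<dots> = emeasure std_normal S"
    by (rule emeasure_std_gaussian_inner) (use assms in auto)
  finally show ?thesis .
qed

lemma std_normal_cdf_uminus: "std_normal_cdf (- a) = 1 - std_normal_cdf a"
proof -
  interpret prob_space std_normal by (rule prob_space_std_normal)
  \<comment> \<open>Reflection turns \<open>{..- a}\<close> into \<open>{a..}\<close>, the
    complement of \<open>{..<a}\<close>.\<close>
  have "{x. - x \<in> {..- a}} = space std_normal - {..<a}" by auto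
  moreover have "measure std_normal {..<a} = std_normal_cdf a"
    using emeasure_std_normal_lessThan[of a] by (simp add: measure_def std_normal_cdf_eq)
  ultimately have "measure std_normal {x. - x \<in> {..- a}} = 1 - std_normal_cdf a"
    using prob_compl[of "{..<a}"] by simp
  then show ?thesis
    using emeasure_std_normal_uminus[of "{..- a}"]
    by (simp add: std_normal_cdf_eq measure_def)
qed

lemma std_normal_cdf_nonneg: "0 \<le> std_normal_cdf a"
  by (simp add: std_normal_cdf_eq)

text \<open>Monotonicity combined with the reflection formula. It makes the terms of
  \<open>delta_sup\<close> nonnegative.\<close>

lemma std_normal_cdf_le_half:
  assumes "a \<le> 0"
  shows "std_normal_cdf a \<le> 1 / 2"
proof -
  have "std_normal_cdf a \<le> std_normal_cdf (- a)"
    unfolding std_normal_cdf_eq using assms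
    by (intro finite_measure.finite_measure_mono prob_space.finite_measure prob_space_std_normal) auto
  then show ?thesis by (simp add: std_normal_cdf_uminus)
qed

lemma std_normal_cdf_0: "std_normal_cdf 0 = 1 / 2"
  using std_normal_cdf_uminus[of 0] by simp

section \<open>The minimum of two Gaussians with different means\<close>

text \<open>The minimum of N(0, I) and N(-g, I) with explicit densities instead of
  \<open>RN_deriv\<close>, hence jointly measurable in \<open>g\<close> and \<open>w\<close>;
  \<open>min_measure_gaussian\<close> makes the link.\<close>

definition gaussian_overlap :: "'a::euclidean_space \<Rightarrow> 'a measure" where
  "gaussian_overlap g =
     density lborel (\<lambda>w. ennreal (min (std_gaussian_density w) (std_gaussian_density (w + g))))"

lemma sets_gaussian_overlap [simp, measurable_cong]: "sets (gaussian_overlap g) = sets borel"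
  by (simp add: gaussian_overlap_def)

lemma space_gaussian_overlap [simp]: "space (gaussian_overlap g) = UNIV"
  by (simp add: gaussian_overlap_def)

lemma nn_integral_lborel_translate:
  fixes g :: "'a::euclidean_space"
  assumes [measurable]: "F \<in> borel_measurable borel"
  shows "(\<integral>\<^sup>+x. F (x + g) \<partial>lborel) = (\<integral>\<^sup>+x. F x \<partial>lborel)"
  by (subst (2) lborel_distr_plus[symmetric, of g], subst nn_integral_distr) (auto simp: add.commute)

lemma distr_std_gaussian_plus:
  fixes m :: "'a::euclidean_space"
  shows "distr std_gaussian borel ((+) m) = density lborel (\<lambda>x. ennreal (std_gaussian_density (x - m)))"
proof (rule measure_eqI)
  fix S assume "S \<in> sets (distr std_gaussian borel ((+) m))"
  then have [measurable]: "S \<in> sets borel" by simp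
  have "emeasure (distr std_gaussian borel ((+) m)) S = (\<integral>\<^sup>+x. indicator S x \<partial>distr std_gaussian borel ((+) m))"
    by simp
  also have "\<dots> = (\<integral>\<^sup>+x. indicator S (m + x) \<partial>std_gaussian)"
    by (rule nn_integral_distr) auto
  \<comment> \<open>Inserting \<open>+ m - m\<close> makes the integrand a function of
    \<open>x + m\<close>, ready for translation invariance.\<close>
  also have "\<dots> = (\<integral>\<^sup>+x. ennreal (std_gaussian_density (x + m - m)) * indicator S (x + m) \<partial>lborel)"
    unfolding std_gaussian_def by (subst nn_integral_density) (auto simp: add.commute)
  also have "\<dots> = (\<integral>\<^sup>+x. ennreal (std_gaussian_density (x - m)) * indicator S x \<partial>lborel)"
    by (rule nn_integral_lborel_translate) measurable
  finally show "emeasure (distr std_gaussian borel ((+) m)) S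
      = emeasure (density lborel (\<lambda>x. ennreal (std_gaussian_density (x - m)))) S"
    by (subst emeasure_density) auto
qed simp

lemma emeasure_gaussian_overlap_le:
  assumes [measurable]: "S \<in> sets borel"
  shows "emeasure (gaussian_overlap g) S \<le> emeasure std_gaussian S"
    and "emeasure (gaussian_overlap g) S \<le> emeasure (distr std_gaussian borel ((+) (- g))) S"
proof -
  show "emeasure (gaussian_overlap g) S \<le> emeasure std_gaussian S"
    by (auto simp: gaussian_overlap_def std_gaussian_def emeasure_density
        intro!: nn_integral_mono mult_right_mono ennreal_leI)
  show "emeasure (gaussian_overlap g) S \<le> emeasure (distr std_gaussian borel ((+) (- g))) S"
    by (auto simp: gaussian_overlap_def distr_std_gaussian_plus emeasure_density
        intro!: nn_integral_mono mult_right_mono ennreal_leI)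
qed

text \<open>An inequality suffices, since a coupling only has to have mass at least
  \<open>1 - \<delta>\<close>.\<close>

lemma gaussian_overlap_mass_ge:
  fixes g :: "'a::euclidean_space"
  shows "ennreal (2 * std_normal_cdf (- (norm g / 2))) \<le> emeasure (gaussian_overlap g) UNIV"
proof (cases "g = 0")
  \<comment> \<open>Without a shift there is no direction to project onto; the two densities
    coincide and the bound is \<open>2 * std_normal_cdf 0 = 1\<close>.\<close>
  case True
  then have "gaussian_overlap g = std_gaussian"
    by (simp add: gaussian_overlap_def std_gaussian_def)
  then show ?thesis
    using True std_gaussian.emeasure_space_1[where 'a='a] by (simp add: std_normal_cdf_0)
next
  case False
  define e where "e = g /\<^sub>R norm g"
  have e: "norm e = 1" "norm (- e) = 1" and g: "g = norm g *\<^sub>R e"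
    using False by (auto simp: e_def)
  have pos: "norm g > 0" using False by simp
  let ?c = "norm g / 2"
  \<comment> \<open>The side of the bisecting hyperplane that contains the mean \<open>- g\<close>.
    There the density centred at 0 is the smaller one.\<close>
  define H where "H = {w. w \<bullet> e \<in> {..- ?c}}"
  have [measurable]: "H \<in> sets borel" unfolding H_def by measurable
  have cmp: "std_gaussian_density w \<le> std_gaussian_density (w + g) \<longleftrightarrow> w \<in> H" for w
  proof -
    \<comment> \<open>Expand the squared norm of \<open>w + g\<close> with
      \<open>g = norm g *\<^sub>R e\<close>; the substitution is confined to the inner product so
      that \<open>norm g\<close> itself stays intact.\<close>
    have "std_gaussian_density w \<le> std_gaussian_density (w + g) \<longleftrightarrow> 2 * norm g * (w \<bullet> e) + norm g * norm g \<le> 0"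
      unfolding std_gaussian_density_le_iff
      by (subst (1 2) g) (use e in \<open>simp add: algebra_simps inner_commute norm_eq_1\<close>)
    also have "2 * norm g * (w \<bullet> e) + norm g * norm g = 2 * norm g * (w \<bullet> e + ?c)"
      by (simp add: algebra_simps)
    also have "\<dots> \<le> 0 \<longleftrightarrow> w \<bullet> e + ?c \<le> 0"
      using pos by (simp add: mult_le_0_iff)
    finally show ?thesis by (auto simp: H_def)
  qed
  have "emeasure (gaussian_overlap g) H = emeasure std_gaussian H"
    unfolding gaussian_overlap_def std_gaussian_def
    by (auto simp: emeasure_density cmp[symmetric] intro!: nn_integral_cong split: split_indicator)
  also have "\<dots> = ennreal (std_normal_cdf (- ?c))"
    unfolding H_def by (subst emeasure_std_gaussian_inner[OF e(1)]) (auto simp: emeasure_std_normal_atMost)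
  finally have 1: "emeasure (gaussian_overlap g) H = ennreal (std_normal_cdf (- ?c))" .
  have "emeasure (gaussian_overlap g) (- H) = emeasure (distr std_gaussian borel ((+) (- g))) (- H)"
    unfolding gaussian_overlap_def distr_std_gaussian_plus
    by (auto simp: emeasure_density cmp[symmetric] intro!: nn_integral_cong split: split_indicator)
  \<comment> \<open>Recentring at \<open>- g\<close> adds \<open>norm g\<close> to the projection,
    so the complement of \<open>H\<close> becomes \<open>w \<bullet> e > norm g / 2\<close>, an open
    half-space in direction \<open>- e\<close>.\<close>
  also have "\<dots> = emeasure std_gaussian {w. w \<bullet> (- e) \<in> {..<- ?c}}"
  proof (subst emeasure_distr)
    have "g \<bullet> e = norm g"
      using e by (subst g) (simp add: norm_eq_1)
    then have "(+) (- g) -` (- H) = {w. w \<bullet> (- e) \<in> {..<- ?c}}"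
      unfolding H_def vimage_def by (auto simp: algebra_simps)
    then show "emeasure std_gaussian ((+) (- g) -` (- H) \<inter> space std_gaussian)
        = emeasure std_gaussian {w. w \<bullet> (- e) \<in> {..<- ?c}}" by simp
  qed auto
  also have "\<dots> = ennreal (std_normal_cdf (- ?c))"
    by (subst emeasure_std_gaussian_inner[OF e(2)]) (auto simp: emeasure_std_normal_lessThan)
  finally have 2: "emeasure (gaussian_overlap g) (- H) = ennreal (std_normal_cdf (- ?c))" .
  have "emeasure (gaussian_overlap g) UNIV = emeasure (gaussian_overlap g) H + emeasure (gaussian_overlap g) (- H)"
    by (subst plus_emeasure) auto
  then show ?thesis
    by (simp add: 1 2 std_normal_cdf_nonneg flip: ennreal_plus)
qed

text \<open>Integrating a jointly measurable density leaves a measurable function of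
  \<open>g\<close>. This is the source of the measurability of the coupling kernel.\<close>

lemma gaussian_overlap_measurable [measurable]:
  "gaussian_overlap \<in> borel \<rightarrow>\<^sub>M subprob_algebra (borel :: 'a::euclidean_space measure)"
proof (rule measurable_subprob_algebra)
  fix g :: 'a
  have "emeasure (gaussian_overlap g) UNIV \<le> 1"
    using emeasure_gaussian_overlap_le(1)[of UNIV g] std_gaussian.emeasure_space_1[where 'a='a] by simp
  then show "subprob_space (gaussian_overlap g)"
    by (intro subprob_spaceI) auto
next
  fix S :: "'a set" assume [measurable]: "S \<in> sets borel"
  show "(\<lambda>g. emeasure (gaussian_overlap g) S) \<in> borel_measurable borel"
    unfolding gaussian_overlap_def by (subst emeasure_density) measurable
qed simp

section \<open>Identity covariance and the minimum measure\<close>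

lemma gaussian_density_mat_1:
  fixes m x :: "real^'n"
  shows "gaussian_density m (mat 1) x = std_gaussian_density (x - m)"
proof -
  \<comment> \<open>\<open>matrix_inv\<close> chooses some two-sided inverse; for the identity
    matrix the unit laws leave only one candidate.\<close>
  have "matrix_inv (mat 1 :: real^'n^'n) = mat 1"
    unfolding matrix_inv_def by (rule some_equality) (auto simp: matrix_mul_lid matrix_mul_rid)
  then show ?thesis
    by (simp add: gaussian_density_def std_gaussian_density_eq matrix_vector_mul_lid)
qed

lemma gaussian_mat_1: "gaussian m (mat 1) = distr std_gaussian borel ((+) m)"
  by (simp add: gaussian_def gaussian_density_mat_1 distr_std_gaussian_plus)

lemma gaussian_measurable:
  assumes [measurable]: "m \<in> M \<rightarrow>\<^sub>M borel"
  shows "(\<lambda>a. gaussian (m a) (mat 1)) \<in> M \<rightarrow>\<^sub>M prob_algebra borel"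
  unfolding gaussian_mat_1
proof (rule measurable_distr_prob_space2[where M=borel])
  show "(\<lambda>a. std_gaussian) \<in> M \<rightarrow>\<^sub>M prob_algebra borel"
    by (rule measurable_const) (simp add: space_prob_algebra prob_space_std_gaussian)
qed measurable

text \<open>Radon-Nikodym derivatives are unique up to Lebesgue null sets, and
  \<open>density\<close> does not see null sets.\<close>

lemma min_measure_gaussian:
  "min_measure (gaussian 0 (mat 1)) (gaussian (- g) (mat 1)) = gaussian_overlap g"
proof -
  have RN: "AE x in lborel. ennreal (std_gaussian_density (x - m)) = RN_deriv lborel (gaussian m (mat 1)) x"
    for m :: "real^'n"
    by (rule sigma_finite_measure.RN_deriv_unique[OF sigma_finite_lborel])
      (auto simp: gaussian_def gaussian_density_mat_1)
  have min: "ennreal (min a b) = min (ennreal a) (ennreal b)" if "0 \<le> a" "0 \<le> b" for a b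
    using that by (simp add: min_def)
  show ?thesis
    unfolding min_measure_def gaussian_overlap_def
  proof (rule density_cong)
    show "AE x in lborel. min (RN_deriv lborel (gaussian 0 (mat 1)) x) (RN_deriv lborel (gaussian (- g) (mat 1)) x)
        = ennreal (min (std_gaussian_density x) (std_gaussian_density (x + g)))"
      using RN[of 0] RN[of "- g"] by eventually_elim (simp add: min)
  qed auto
qed

section \<open>The coupling kernel\<close>

lemma return_pair_measure:
  assumes "a \<in> space M" "b \<in> space N"
  shows "return M a \<Otimes>\<^sub>M return N b = return (M \<Otimes>\<^sub>M N) (a, b)"
proof (rule pair_measure_eqI)
  show "sigma_finite_measure (return M a)" "sigma_finite_measure (return N b)"
    using assms by (auto intro!: finite_measure.sigma_finite_measure prob_space.finite_measure prob_space_return)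
qed (auto simp: indicator_times cong: sets_pair_measure_cong)

text \<open>The inner bind substitutes \<open>\<gamma> + w\<close> for \<open>wh\<close>, the
  product of the two Dirac measures is a Dirac measure at a pair, and binding with Dirac measures is
  a push-forward.\<close>

lemma coupling_kernel_eq:
  fixes f :: "real^'n \<Rightarrow> 'u \<Rightarrow> 'p \<Rightarrow> real^'n"
  shows "coupling_kernel f \<theta>\<^sub>0 \<theta> xh x u =
     distr (gaussian_overlap (deviation f \<theta>\<^sub>0 x u \<theta>)) (borel \<Otimes>\<^sub>M borel)
       (\<lambda>w. (f xh u \<theta>\<^sub>0 + (deviation f \<theta>\<^sub>0 x u \<theta> + w), f x u \<theta> + w))"
proof -
  have "bind (return borel (c + w)) (\<lambda>wh. return borel (a + wh) \<Otimes>\<^sub>M return borel (b + w))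
      = return (borel \<Otimes>\<^sub>M borel) (a + (c + w), b + w)" for a b c w :: "real^'n"
    by (subst bind_return[where N="borel \<Otimes>\<^sub>M borel"]) (auto simp: return_pair_measure)
  then show ?thesis
    unfolding coupling_kernel_def Let_def min_measure_gaussian
    by (simp add: bind_return_distr')
qed

lemma coupling_kernel_measurable:
  fixes f :: "real^'n \<Rightarrow> 'u::polish_space \<Rightarrow> 'p \<Rightarrow> real^'n"
  assumes [measurable]: "(\<lambda>(x, u). f x u \<theta>) \<in> borel \<Otimes>\<^sub>M borel \<rightarrow>\<^sub>M borel"
    "(\<lambda>(x, u). f x u \<theta>\<^sub>0) \<in> borel \<Otimes>\<^sub>M borel \<rightarrow>\<^sub>M borel"
  shows "(\<lambda>(xh, x, u). coupling_kernel f \<theta>\<^sub>0 \<theta> xh x u)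
    \<in> borel \<Otimes>\<^sub>M (borel \<Otimes>\<^sub>M borel) \<rightarrow>\<^sub>M subprob_algebra (borel \<Otimes>\<^sub>M borel)"
  unfolding coupling_kernel_eq deviation_def case_prod_beta
proof (rule measurable_distr2[where M=borel])
qed (measurable)

text \<open>For equal states the deviation cancels the difference of the two drifts, so both
  components are \<open>f x u \<theta> + w\<close>.\<close>

lemma emeasure_coupling_kernel_diagonal:
  assumes "S \<in> sets (borel \<Otimes>\<^sub>M borel)"
  shows "emeasure (coupling_kernel f \<theta>\<^sub>0 \<theta> x x u) S =
    emeasure (gaussian_overlap (deviation f \<theta>\<^sub>0 x u \<theta>)) {w. (f x u \<theta> + w, f x u \<theta> + w) \<in> S}"
  unfolding coupling_kernel_eq
  by (subst emeasure_distr) (use assms in \<open>auto simp: deviation_def vimage_def\<close>)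

text \<open>Rectangles \<open>S \<times> UNIV\<close> and \<open>UNIV \<times> S\<close> yield the
  marginal bounds, \<open>UNIV\<close> the bound on the mass, and general \<open>S\<close> the
  control refinement.\<close>

lemma emeasure_coupling_kernel_diagonal_le:
  assumes S [measurable]: "S \<in> sets (borel \<Otimes>\<^sub>M borel)"
  shows "emeasure (coupling_kernel f \<theta>\<^sub>0 \<theta> x x u) S \<le> emeasure (gaussian (f x u \<theta>\<^sub>0) (mat 1)) {y. (y, y) \<in> S}"
    and "emeasure (coupling_kernel f \<theta>\<^sub>0 \<theta> x x u) S \<le> emeasure (gaussian (f x u \<theta>) (mat 1)) {y. (y, y) \<in> S}"
proof -
  let ?m = "f x u \<theta>" and ?g = "deviation f \<theta>\<^sub>0 x u \<theta>"
  let ?T = "{w. (?m + w, ?m + w) \<in> S}"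
  have [measurable]: "?T \<in> sets borel" "{y. (y, y) \<in> S} \<in> sets borel" by measurable
  \<comment> \<open>Shifting by \<open>?m\<close> moves the mean \<open>- ?g\<close> to the nominal
    drift \<open>f x u \<theta>\<^sub>0\<close>.\<close>
  have "emeasure (distr std_gaussian borel ((+) (- ?g))) ?T
      = emeasure (gaussian (f x u \<theta>\<^sub>0) (mat 1)) {y. (y, y) \<in> S}"
    unfolding gaussian_mat_1 by (simp add: emeasure_distr vimage_def deviation_def)
  then show "emeasure (coupling_kernel f \<theta>\<^sub>0 \<theta> x x u) S \<le> emeasure (gaussian (f x u \<theta>\<^sub>0) (mat 1)) {y. (y, y) \<in> S}"
    using emeasure_gaussian_overlap_le(2)[of ?T ?g] by (simp add: emeasure_coupling_kernel_diagonal)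
  have "emeasure std_gaussian ?T = emeasure (gaussian ?m (mat 1)) {y. (y, y) \<in> S}"
    unfolding gaussian_mat_1 by (simp add: emeasure_distr vimage_def)
  then show "emeasure (coupling_kernel f \<theta>\<^sub>0 \<theta> x x u) S \<le> emeasure (gaussian (f x u \<theta>) (mat 1)) {y. (y, y) \<in> S}"
    using emeasure_gaussian_overlap_le(1)[of ?T ?g] by (simp add: emeasure_coupling_kernel_diagonal)
qed

lemma delta_sup_bounds:
  assumes "\<theta> \<in> \<Theta>"
  shows "0 \<le> delta_sup f \<Theta> \<theta>\<^sub>0 x u" "delta_sup f \<Theta> \<theta>\<^sub>0 x u \<le> 1"
    "1 - delta_sup f \<Theta> \<theta>\<^sub>0 x u \<le> 2 * std_normal_cdf (- (norm (deviation f \<theta>\<^sub>0 x u \<theta>) / 2))"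
proof -
  let ?D = "\<lambda>\<theta>. 1 - 2 * std_normal_cdf (- (1 / 2) * norm (deviation f \<theta>\<^sub>0 x u \<theta>))"
  \<comment> \<open>A real supremum dominates its terms only over a bounded set; the bound 1 comes
    from the cdf being nonnegative.\<close>
  have "bdd_above (?D ` \<Theta>)"
    by (rule bdd_aboveI2[where M=1]) (simp add: std_normal_cdf_nonneg)
  then have *: "?D \<theta> \<le> delta_sup f \<Theta> \<theta>\<^sub>0 x u"
    unfolding delta_sup_def using assms by (rule cSUP_upper2[rotated 2, OF order_refl])
  then show "1 - delta_sup f \<Theta> \<theta>\<^sub>0 x u \<le> 2 * std_normal_cdf (- (norm (deviation f \<theta>\<^sub>0 x u \<theta>) / 2))"
    by simp
  show "0 \<le> delta_sup f \<Theta> \<theta>\<^sub>0 x u"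
    using * std_normal_cdf_le_half[of "- (1 / 2) * norm (deviation f \<theta>\<^sub>0 x u \<theta>)"] by simp
  show "delta_sup f \<Theta> \<theta>\<^sub>0 x u \<le> 1"
    unfolding delta_sup_def using assms by (intro cSUP_least) (auto simp: std_normal_cdf_nonneg)
qed

text \<open>The diagonal is closed, and by second countability the product sigma-algebra is the
  Borel one.\<close>

lemma diagonal_sets: "{(xh, x). x = xh} \<in> sets (borel \<Otimes>\<^sub>M (borel :: 'a::polish_space measure))"
proof -
  have "closed {p :: 'a \<times> 'a. snd p = fst p}"
    by (intro closed_Collect_eq continuous_intros)
  moreover have "{p :: 'a \<times> 'a. snd p = fst p} = {(xh, x). x = xh}" by auto
  ultimately show ?thesis
    unfolding borel_prod by (metis borel_closed)
qed

lemma subprob_coupling_coupling_kernel: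
  fixes f :: "real^'n \<Rightarrow> 'u \<Rightarrow> 'p \<Rightarrow> real^'n"
  assumes "\<theta> \<in> \<Theta>"
  shows "subprob_coupling {(xh, x). x = xh} (delta_sup f \<Theta> \<theta>\<^sub>0 x u)
    (gaussian (f x u \<theta>\<^sub>0) (mat 1)) (gaussian (f x u \<theta>) (mat 1)) (coupling_kernel f \<theta>\<^sub>0 \<theta> x x u)"
proof -
  let ?v = "coupling_kernel f \<theta>\<^sub>0 \<theta> x x u" and ?g = "deviation f \<theta>\<^sub>0 x u \<theta>"
  \<comment> \<open>A measurable map takes values in the space of its target; here the parameter is
    the mean itself.\<close>
  have prob: "gaussian m (mat 1) \<in> space (prob_algebra borel)" for m :: "real^'n"
    using measurable_space[OF gaussian_measurable[of id borel], of m] by simp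
  have UNIV_sets: "UNIV \<in> sets (borel \<Otimes>\<^sub>M (borel :: (real^'n) measure))"
    using sets.top[of "borel \<Otimes>\<^sub>M (borel :: (real^'n) measure)"] by (simp add: space_pair_measure)
  have mass: "emeasure ?v UNIV = emeasure (gaussian_overlap ?g) UNIV"
    by (simp add: emeasure_coupling_kernel_diagonal UNIV_sets)
  show ?thesis
    unfolding subprob_coupling_def
  proof (intro conjI ballI)
    show "0 \<le> delta_sup f \<Theta> \<theta>\<^sub>0 x u" "delta_sup f \<Theta> \<theta>\<^sub>0 x u \<le> 1"
      by (rule delta_sup_bounds(1,2)[OF assms])+
    show "gaussian (f x u \<theta>\<^sub>0) (mat 1) \<in> space (prob_algebra borel)"
      "gaussian (f x u \<theta>) (mat 1) \<in> space (prob_algebra borel)"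
      by (rule prob)+
    show "sets ?v = sets (borel \<Otimes>\<^sub>M borel)"
      by (simp add: coupling_kernel_eq)
    show "emeasure ?v UNIV \<le> 1"
      using emeasure_coupling_kernel_diagonal_le(1)[OF UNIV_sets] in_space_prob_algebra[OF prob] by simp
    show "ennreal (1 - delta_sup f \<Theta> \<theta>\<^sub>0 x u) \<le> emeasure ?v UNIV"
      unfolding mass
      by (rule order_trans[OF ennreal_leI gaussian_overlap_mass_ge]) (rule delta_sup_bounds(3)[OF assms])
    show "emeasure ?v UNIV = emeasure ?v {(xh, x). x = xh}"
      by (simp add: emeasure_coupling_kernel_diagonal UNIV_sets diagonal_sets)
  next
    fix S :: "(real^'n) set" assume "S \<in> sets borel"
    then show "emeasure ?v (S \<times> UNIV) \<le> emeasure (gaussian (f x u \<theta>\<^sub>0) (mat 1)) S"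
      "emeasure ?v (UNIV \<times> S) \<le> emeasure (gaussian (f x u \<theta>) (mat 1)) S"
      using emeasure_coupling_kernel_diagonal_le(1)[of "S \<times> UNIV"]
        emeasure_coupling_kernel_diagonal_le(2)[of "UNIV \<times> S"] by simp_all
  qed
qed

section \<open>The systems, the refinement and the final assembly\<close>

lemma is_gmdp_noisy_system:
  assumes "(\<lambda>(x, u). f x u \<theta>) \<in> borel \<Otimes>\<^sub>M borel \<rightarrow>\<^sub>M borel" "h \<in> borel \<rightarrow>\<^sub>M borel"
  shows "is_gmdp (noisy_system f h x\<^sub>0 \<theta>)"
  using assms gaussian_measurable[OF assms(1)]
  by (simp add: is_gmdp_def noisy_system_def case_prod_beta)

lemma valid_control_refinement_state_mapping:
  fixes f :: "real^'n \<Rightarrow> 'u::polish_space \<Rightarrow> 'p \<Rightarrow> real^'n"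
  assumes [measurable]: "(\<lambda>(x, u). f x u \<theta>\<^sub>0) \<in> borel \<Otimes>\<^sub>M borel \<rightarrow>\<^sub>M borel"
  shows "valid_control_refinement (noisy_system f h x\<^sub>0 \<theta>)
    {(xh, x). x = xh} (\<lambda>xh x uh. uh) (coupling_kernel f \<theta>\<^sub>0 \<theta>) (state_mapping f \<theta>\<^sub>0)"
  unfolding valid_control_refinement_def
proof (intro conjI ballI allI, safe)
  show "(\<lambda>(xh, x, x', uh). state_mapping f \<theta>\<^sub>0 xh x x' uh)
      \<in> borel \<Otimes>\<^sub>M (borel \<Otimes>\<^sub>M (borel \<Otimes>\<^sub>M borel)) \<rightarrow>\<^sub>M prob_algebra borel"
    unfolding state_mapping_def case_prod_beta by measurable
next
  fix S :: "((real^'n) \<times> (real^'n)) set" and x u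
  assume S [measurable]: "S \<in> sets (borel \<Otimes>\<^sub>M borel)"
  have [measurable]: "{y. (y, y) \<in> S} \<in> sets borel" by measurable
  \<comment> \<open>With equal states the two nominal drifts cancel, so the mapping is the Dirac
    measure at \<open>x'\<close> and only the diagonal section of \<open>S\<close> is seen.\<close>
  have "(\<integral>\<^sup>+ x'. (\<integral>\<^sup>+ xh'. indicator S (xh', x') \<partial>state_mapping f \<theta>\<^sub>0 x x x' u) \<partial>gaussian (f x u \<theta>) (mat 1))
      = (\<integral>\<^sup>+ x'. indicator {y. (y, y) \<in> S} x' \<partial>gaussian (f x u \<theta>) (mat 1))"
    unfolding state_mapping_def
    by (intro nn_integral_cong, subst nn_integral_return) (auto simp: indicator_def)
  also have "\<dots> = emeasure (gaussian (f x u \<theta>) (mat 1)) {y. (y, y) \<in> S}"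
    by (rule nn_integral_indicator) (simp add: gaussian_mat_1)
  finally show "emeasure (coupling_kernel f \<theta>\<^sub>0 \<theta> x x u) S
      \<le> (\<integral>\<^sup>+ x'. (\<integral>\<^sup>+ xh'. indicator S (xh', x') \<partial>state_mapping f \<theta>\<^sub>0 x x x' u)
          \<partial>kernel (noisy_system f h x\<^sub>0 \<theta>) x u)"
    using emeasure_coupling_kernel_diagonal_le(2)[OF S] by (simp add: noisy_system_def)
qed

theorem theorem4:
  fixes \<Theta> :: "(real^'p) set" and \<theta>\<^sub>0 :: "real^'p"
    and f :: "real^'n \<Rightarrow> 'u::polish_space \<Rightarrow> real^'p \<Rightarrow> real^'n"
    and h :: "real^'n \<Rightarrow> 'y::polish_space"
    and d\<^sub>Y :: "'y \<Rightarrow> 'y \<Rightarrow> real"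
    and d :: "real^'n \<Rightarrow> 'u \<Rightarrow> real"
    and x\<^sub>0 xh\<^sub>0 :: "real^'n"
  assumes "polytope \<Theta>" and "\<theta>\<^sub>0 \<in> \<Theta>"
    and "Metric_space UNIV d\<^sub>Y"
    and "\<And>\<theta>. \<theta> \<in> \<Theta> \<Longrightarrow> (\<lambda>(x, u). f x u \<theta>) \<in> borel \<Otimes>\<^sub>M borel \<rightarrow>\<^sub>M borel"
    and "h \<in> borel \<rightarrow>\<^sub>M borel"
    and "\<And>x u \<theta>. \<theta> \<in> \<Theta> \<Longrightarrow> norm (f x u \<theta> - f x u \<theta>\<^sub>0) \<le> d x u"
    and "xh\<^sub>0 = x\<^sub>0"
  shows "(\<forall>\<theta>\<in>\<Theta>. sub_simulation d\<^sub>Y 0 (delta_sup f \<Theta> \<theta>\<^sub>0)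
             (noisy_system f h xh\<^sub>0 \<theta>\<^sub>0) (noisy_system f h x\<^sub>0 \<theta>)
             {(xh, x). x = xh} (\<lambda>xh x uh. uh) (coupling_kernel f \<theta>\<^sub>0 \<theta>)) \<and>
         (\<forall>\<theta>\<in>\<Theta>. valid_control_refinement (noisy_system f h x\<^sub>0 \<theta>)
             {(xh, x). x = xh} (\<lambda>xh x uh. uh) (coupling_kernel f \<theta>\<^sub>0 \<theta>) (state_mapping f \<theta>\<^sub>0))"
proof (intro conjI ballI)
  note meas = assms(4) and h = assms(5)
  fix \<theta> assume \<theta>: "\<theta> \<in> \<Theta>"
  show "valid_control_refinement (noisy_system f h x\<^sub>0 \<theta>)
      {(xh, x). x = xh} (\<lambda>xh x uh. uh) (coupling_kernel f \<theta>\<^sub>0 \<theta>) (state_mapping f \<theta>\<^sub>0)"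
    by (rule valid_control_refinement_state_mapping[where f=f and \<theta>\<^sub>0=\<theta>\<^sub>0, OF meas[OF \<open>\<theta>\<^sub>0 \<in> \<Theta>\<close>]])
  have "is_interface (\<lambda>(xh::real^'n) (x::real^'n) (uh::'u). uh)"
    unfolding is_interface_def case_prod_beta by measurable
  \<comment> \<open>Related states are equal and share the output map, so the output condition with
    \<open>\<epsilon> = 0\<close> reduces to this.\<close>
  moreover have "d\<^sub>Y y y = 0" for y
    using Metric_space.mdist_zero[OF assms(3)] by simp
  moreover have "is_gmdp (noisy_system f h x\<^sub>0 \<theta>')" if "\<theta>' \<in> \<Theta>" for \<theta>'
    by (rule is_gmdp_noisy_system[where f=f and \<theta>=\<theta>', OF meas[OF that] h])
  ultimately show "sub_simulation d\<^sub>Y 0 (delta_sup f \<Theta> \<theta>\<^sub>0)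
      (noisy_system f h xh\<^sub>0 \<theta>\<^sub>0) (noisy_system f h x\<^sub>0 \<theta>)
      {(xh, x). x = xh} (\<lambda>xh x uh. uh) (coupling_kernel f \<theta>\<^sub>0 \<theta>)"
    unfolding sub_simulation_def \<open>xh\<^sub>0 = x\<^sub>0\<close>
    using coupling_kernel_measurable[where f=f and \<theta>=\<theta> and \<theta>\<^sub>0=\<theta>\<^sub>0, OF meas[OF \<theta>] meas[OF \<open>\<theta>\<^sub>0 \<in> \<Theta>\<close>]] diagonal_sets
      subprob_coupling_coupling_kernel[OF \<theta>] \<theta> \<open>\<theta>\<^sub>0 \<in> \<Theta>\<close>
    by (auto simp: noisy_system_def)
qed

end
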